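(* Among all hexagons (not necessarily convex) with area $1$, neither $\rho_1$ nor $\rho_2$ has a maximizer. That is, for each $j\in\{1,2\}$ there is no hexagon $H_0$ of area $1$ such that $\rho_j(H)\le\rho_j(H_0)$ for every hexagon $H$ of area $1$.
   Context: For a bounded simply connected region $\Omega\subseteq\mathbb{C}$ whose boundary is a Jordan curve and $N\in\mathbb{N}$, let $\mathcal{P}_N$ be the space of complex polynomials in $z$ of degree at most $N$, and let $dA$ denote area measure. Define $$\rho_N(\Omega):=\min_{p\in\mathcal{P}_N}\int_\Omega|\bar z-p(z)|^2\,dA(z),$$ the square of the distance from $\bar z$ to $\mathcal{P}_N$ in $L^2(\Omega,dA)$. Here a hexagon means the region bounded by a simple closed polygon with six sides; convexity is not required. *)

theory Defs
  imports "HOL-Analysis.Analysis" "HOL-Computational_Algebra.Polynomial"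
begin

text \<open>Lebesgue measure on \<^typ>\<open>complex\<close> (as a two-dimensional Euclidean space) is area measure.
  The minimum is written as an infimum, i.e. as the squared \<open>L\<^sup>2\<close> distance: the set of values is
  nonempty and bounded below, and on a bounded region the infimum is attained because the
  polynomials of degree at most \<open>N\<close> form a finite-dimensional space.\<close>

definition rho :: "nat \<Rightarrow> complex set \<Rightarrow> real" where
  "rho N \<Omega> = (INF p\<in>{p :: complex poly. degree p \<le> N}.
                 LINT z:\<Omega>|lebesgue. (cmod (cnj z - poly p z))\<^sup>2)"

fun polyline :: "complex list \<Rightarrow> real \<Rightarrow> complex" where
  "polyline [] = linepath 0 0"
| "polyline [a] = linepath a a"
| "polyline [a, b] = linepath a b"
| "polyline (a # b # c # vs) = linepath a b +++ polyline (b # c # vs)"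

definition closed_polyline :: "complex list \<Rightarrow> real \<Rightarrow> complex" where
  "closed_polyline vs = polyline (vs @ [hd vs])"

text \<open>The non-collinearity condition says that all six vertices are genuine corners, so that
  the boundary has exactly six sides (a pentagon with an extra marked boundary point is excluded).
  Reflex angles are allowed.\<close>

definition hexagon :: "complex set \<Rightarrow> bool" where
  "hexagon H \<longleftrightarrow> (\<exists>vs. length vs = 6 \<and>
     simple_path (closed_polyline vs) \<and>
     (\<forall>i<6. \<not> collinear {vs ! i, vs ! ((i + 1) mod 6), vs ! ((i + 2) mod 6)}) \<and>
     H = inside (path_image (closed_polyline vs)))"

end

theory Submission imports Defs begin

text \<open>On thin L-shapes of area 1 with legs of length \<open>L\<close> the value of \<open>\<rho>\<^sub>2\<close> (hence of
  \<open>\<rho>\<^sub>1\<close>) is at least a constant times \<open>L\<^sup>2\<close>, so it is unbounded: a quadratic polynomial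
  close to \<open>cnj z\<close> on the horizontal leg is close to \<open>z\<close> there, so it stays close to \<open>z\<close> on the
  vertical leg, where \<open>cnj z\<close> is close to \<open>- z\<close>.\<close>

section \<open>Recognizing the inside of a Jordan curve\<close>

text \<open>A connected set that meets \<open>S\<close> but not \<open>frontier S\<close> lies in
  \<open>S\<close>. Applied to the components of the complement of the curve through points of
  \<open>S\<close>, this makes them bounded; applied to the inside, which is connected by the Jordan
  curve theorem, it gives the other inclusion.\<close>

lemma inside_simple_closed_path_eqI:
  fixes c :: "real \<Rightarrow> complex"
  assumes "simple_path c" "pathfinish c = pathstart c"
    and "bounded S" "S \<noteq> {}" "S \<inter> path_image c = {}" "frontier S \<subseteq> path_image c"
  shows "inside (path_image c) = S"
proof
  have J: "connected (inside (path_image c))"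
    using Jordan_inside_outside[OF assms(1,2)] by blast
  show 1: "S \<subseteq> inside (path_image c)"
  proof
    fix x assume x: "x \<in> S"
    let ?C = "connected_component_set (- path_image c) x"
    have xC: "x \<in> ?C" using x assms(5) by auto
    have sub: "?C \<subseteq> - path_image c" by (rule connected_component_subset)
    have "?C \<subseteq> S"
    proof (rule ccontr)
      assume "\<not> ?C \<subseteq> S"
      then have "?C \<inter> frontier S \<noteq> {}"
        using x xC by (intro connected_Int_frontier connected_connected_component) blast+
      then show False using sub assms(6) by blast
    qed
    then have "bounded ?C" using assms(3) bounded_subset by blast
    then show "x \<in> inside (path_image c)" using x assms(5) by (auto simp: inside_def)
  qed
  show "inside (path_image c) \<subseteq> S"
  proof (rule ccontr)
    assume "\<not> inside (path_image c) \<subseteq> S"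
    then have "inside (path_image c) \<inter> frontier S \<noteq> {}"
      using assms(4) 1 by (intro connected_Int_frontier J) blast+
    then show False using assms(6) inside_no_overlap[of "path_image c"] by blast
  qed
qed

section \<open>L-shaped hexagons and their area\<close>

text \<open>For \<open>0 < w < L\<close> the two legs overlap in the open corner square of side
  \<open>w\<close>, so the union of open boxes has no missing seam.\<close>

definition lshape :: "real \<Rightarrow> real \<Rightarrow> complex set" where
  "lshape L w = box 0 (Complex L w) \<union> box 0 (Complex w L)"

text \<open>Counterclockwise from the outer corner; \<open>Complex w w\<close> is the reflex
  corner.\<close>

definition lshape_vertices :: "real \<Rightarrow> real \<Rightarrow> complex list" where
  "lshape_vertices L w =
     [0, Complex L 0, Complex L w, Complex w w, Complex w L, Complex 0 L]"

lemma mem_lshape: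
  "z \<in> lshape L w \<longleftrightarrow>
     0 < Re z \<and> 0 < Im z \<and> (Re z < L \<and> Im z < w \<or> Re z < w \<and> Im z < L)"
  by (auto simp: lshape_def in_box_complex_iff)

lemma open_lshape: "open (lshape L w)"
  by (auto simp: lshape_def open_box)

text \<open>The first side closes up the arc formed by the other five. All sides are parallel to the
  axes, so their intersections are settled by comparing coordinates.\<close>

lemma simple_path_lshape:
  assumes "0 < w" "w < L"
  shows "simple_path (closed_polyline (lshape_vertices L w))"
  unfolding closed_polyline_def lshape_vertices_def using assms
  by (auto intro!: simple_path_join_loop arc_join arc_linepath
      simp: path_image_join closed_segment_same_Re closed_segment_same_Im
        closed_segment_eq_real_ivl complex_eq_iff)

lemma path_image_lshape:
  assumes "0 < w" "w < L"
  shows "path_image (closed_polyline (lshape_vertices L w)) =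
    {z. 0 \<le> Re z \<and> 0 \<le> Im z \<and> 
       (Im z = 0 \<and> Re z \<le> L \<or> Re z = L \<and> Im z \<le> w \<or> Im z = w \<and> w \<le> Re z \<and> Re z \<le> L \<or>
        Re z = w \<and> w \<le> Im z \<and> Im z \<le> L \<or> Im z = L \<and> Re z \<le> w \<or> Re z = 0 \<and> Im z \<le> L)}"
  unfolding closed_polyline_def lshape_vertices_def using assms
  by (auto simp: path_image_join closed_segment_same_Re closed_segment_same_Im
        closed_segment_eq_real_ivl)

lemma closure_lshape:
  assumes "0 < w" "w < L"
  shows "closure (lshape L w) = cbox 0 (Complex L w) \<union> cbox 0 (Complex w L)"
proof -
  have "Complex (w/2) (w/2) \<in> box 0 (Complex L w)" "Complex (w/2) (w/2) \<in> box 0 (Complex w L)"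
    using assms by (auto simp: in_box_complex_iff)
  then have "box 0 (Complex L w) \<noteq> {}" "box 0 (Complex w L) \<noteq> {}" by blast+
  then show ?thesis by (simp add: lshape_def closure_Un closure_box)
qed

lemma hexagon_lshape:
  assumes w: "0 < w" "w < L"
  shows "hexagon (lshape L w)"
  unfolding hexagon_def
proof (intro exI conjI)
  let ?vs = "lshape_vertices L w"
  show "length ?vs = 6" by (simp add: lshape_vertices_def)
  show sp: "simple_path (closed_polyline ?vs)" using w by (rule simple_path_lshape)
  \<comment> \<open>The condition says that the cross product of the edge vectors at
    \<open>b\<close> is nonzero.\<close>
  have nc: "\<not> collinear {a, b, c}"
    if "(Re a - Re b) * (Im c - Im b) \<noteq> (Im a - Im b) * (Re c - Re b)" for a b c :: complex
  proof
    assume "collinear {a, b, c}"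
    then have "a = b \<or> c = b \<or> (\<exists>k. c - b = k *\<^sub>R (a - b))"
      by (subst (asm) collinear_3) (auto simp: collinear_lemma)
    then show False
    proof (elim disjE exE)
      fix k assume "c - b = k *\<^sub>R (a - b)"
      then have "Re c - Re b = k * (Re a - Re b)" "Im c - Im b = k * (Im a - Im b)"
        by (auto simp: complex_eq_iff)
      then show False using that by simp
    qed (use that in auto)
  qed
  show "\<forall>i<6. \<not> collinear {?vs ! i, ?vs ! ((i + 1) mod 6), ?vs ! ((i + 2) mod 6)}"
  proof (intro allI impI)
    fix i :: nat assume "i < 6"
    then consider "i = 0" | "i = 1" | "i = 2" | "i = 3" | "i = 4" | "i = 5" by linarith
    then show "\<not> collinear {?vs ! i, ?vs ! ((i + 1) mod 6), ?vs ! ((i + 2) mod 6)}"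
      by cases (rule nc; use w in \<open>simp add: lshape_vertices_def\<close>)+
  qed
  have "inside (path_image (closed_polyline ?vs)) = lshape L w"
  proof (rule inside_simple_closed_path_eqI[OF sp])
    show "pathfinish (closed_polyline ?vs) = pathstart (closed_polyline ?vs)"
      by (simp add: closed_polyline_def lshape_vertices_def)
    show "bounded (lshape L w)" by (simp add: lshape_def)
    have "Complex (w/2) (w/2) \<in> lshape L w" using w by (simp add: mem_lshape)
    then show "lshape L w \<noteq> {}" by blast
    show "lshape L w \<inter> path_image (closed_polyline ?vs) = {}"
      using w by (auto simp: path_image_lshape mem_lshape)
    have "frontier (lshape L w) = closure (lshape L w) - lshape L w"
      by (simp add: frontier_def interior_open open_lshape)
    then show "frontier (lshape L w) \<subseteq> path_image (closed_polyline ?vs)"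
      using w by (auto simp: closure_lshape path_image_lshape mem_lshape in_cbox_complex_iff)
  qed
  then show "lshape L w = inside (path_image (closed_polyline ?vs))" by simp
qed

lemma measure_lborel_box_complex:
  "Re a \<le> Re b \<Longrightarrow> Im a \<le> Im b \<Longrightarrow>
     measure lborel (box a b) = (Re b - Re a) * (Im b - Im a)"
  by (simp add: measure_lborel_box_eq Basis_complex_def)

lemma measure_lshape:
  assumes "0 < w" "w < L"
  shows "measure lebesgue (lshape L w) = 2 * L * w - w\<^sup>2"
proof -
  let ?A = "box 0 (Complex L w)" and ?B = "box 0 (Complex w L)"
  have "?A \<inter> ?B = box 0 (Complex w w)" using assms by (auto simp: in_box_complex_iff)
  moreover have "measure lborel (?A \<union> ?B) =
      measure lborel ?A + measure lborel ?B - measure lborel (?A \<inter> ?B)"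
    by (intro measure_Un3 fmeasurableI emeasure_lborel_box_finite) auto
  ultimately show ?thesis using assms
    by (simp add: lshape_def measure_completion measure_lborel_box_complex power2_eq_square)
qed

section \<open>Lower bound for the approximation error on an L-shape\<close>

text \<open>The reflection \<open>\<i> * cnj z\<close> in the diagonal, which exchanges the two legs
  of an L-shape.\<close>

definition reflect :: "complex \<Rightarrow> complex" where
  "reflect z = Complex (Im z) (Re z)"

lemma reflect_measurable [measurable]: "reflect \<in> borel_measurable borel"
  unfolding reflect_def Complex_eq
  by (intro borel_measurable_continuous_onI continuous_intros)

text \<open>Lebesgue measure is determined by its values on boxes, and the reflection only swaps the
  side lengths of a box. This allows the error on the vertical leg to be integrated over points of
  the horizontal one.\<close>

lemma distr_lborel_reflect: "distr lborel borel reflect = lborel"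
proof (rule lborel_eqI[symmetric])
  fix l u :: complex
  assume "\<And>b. b \<in> Basis \<Longrightarrow> l \<bullet> b \<le> u \<bullet> b"
  from this[of 1] this[of \<i>] have lu: "Re l \<le> Re u" "Im l \<le> Im u"
    by (auto simp: Basis_complex_def)
  have "reflect -` box l u = box (reflect l) (reflect u)"
    by (auto simp: reflect_def in_box_complex_iff)
  then have "emeasure (distr lborel borel reflect) (box l u) = 
      emeasure lborel (box (reflect l) (reflect u))"
    by (simp add: emeasure_distr)
  also have "\<dots> = (\<Prod>b\<in>Basis. (u - l) \<bullet> b)"
    using lu by (simp add: emeasure_lborel_box_eq Basis_complex_def reflect_def mult.commute)
  finally show "emeasure (distr lborel borel reflect) (box l u) = (\<Prod>b\<in>Basis. (u - l) \<bullet> b)" .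
qed simp

text \<open>Extrapolating \<open>cnj\<close> from the nodes \<open>z\<close>, \<open>z + c\<close>, \<open>z + 2c\<close> to \<open>u = reflect z\<close> gives
  \<open>cnj z + (u - z)\<close>, which misses \<open>cnj u\<close> by \<open>2 \<bar>Re z - Im z\<bar>\<close>, while a quadratic polynomial is
  extrapolated exactly. The Lagrange coefficients are at most 6, 8 and 3 in modulus, and
  \<open>110 = 1 + 6\<^sup>2 + 8\<^sup>2 + 3\<^sup>2\<close> comes from Cauchy-Schwarz.\<close>

lemma quadratic_extrapolation_defect:
  fixes p :: "complex poly" and c :: real
  assumes "degree p \<le> 2" and c: "c > 0" and s: "\<bar>Re z - Im z\<bar> \<le> c"
  defines "g \<equiv> \<lambda>z. cnj z - poly p z"
  shows "4 * (Re z - Im z)\<^sup>2 \<le> 110 * ((cmod (g (reflect z)))\<^sup>2 + (cmod (g z))\<^sup>2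
           + (cmod (g (z + of_real c)))\<^sup>2 + (cmod (g (z + of_real (2 * c))))\<^sup>2)"
proof -
  \<comment> \<open>In the coordinate \<open>t\<close> the three nodes become 0, 1 and 2.\<close>
  define u t where "u = reflect z" and "t = (u - z) / of_real c"
  have u: "u = z + of_real c * t" using c by (simp add: t_def)
  have uz: "u - z = of_real (Re z - Im z) * (-1 + \<i>)"
    by (simp add: u_def reflect_def complex_eq_iff)
  have "cmod (-1 + \<i>) \<le> 2"
    by (rule order_trans[OF norm_triangle_ineq]) simp
  then have "cmod (u - z) \<le> c * 2"
    unfolding uz norm_mult norm_of_real using s c by (intro mult_mono) simp_all
  then have t: "cmod t \<le> 2" using c by (simp add: t_def norm_divide field_simps)
  define A B C D where "A = cmod (g u)" and "B = cmod (g z)"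
    and "C = cmod (g (z + of_real c))" and "D = cmod (g (z + of_real (2 * c)))"
  \<comment> \<open>The Lagrange basis polynomials for the nodes 0, 1, 2, evaluated at
    \<open>t\<close>.\<close>
  define a b d where "a = (t - 1) * (t - 2) / 2" and "b = t * (2 - t)" and "d = t * (t - 1) / 2"
  have p: "poly p x = coeff p 0 + coeff p 1 * x + coeff p 2 * x\<^sup>2" for x
  proof -
    have "poly p x = (\<Sum>i\<le>2. coeff p i * x ^ i)"
      unfolding poly_altdef using assms(1)
      by (intro sum.mono_neutral_left) (auto simp: coeff_eq_0)
    then show ?thesis by (simp add: numeral_2_eq_2)
  qed
  have interp: "poly p u = a * poly p z + b * poly p (z + of_real c) + d * poly p (z + of_real (2*c))"
    unfolding p u a_def b_def d_def by (simp add: field_simps power2_eq_square)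
  \<comment> \<open>The polynomial part cancels by \<open>interp\<close>; for the \<open>cnj\<close>
    part, \<open>a + b + d = 1\<close> and \<open>b + 2 * d = t\<close>.\<close>
  have "g u - (a * g z + b * g (z + of_real c) + d * g (z + of_real (2 * c))) =
      cnj (u - z) - (u - z)"
    unfolding g_def interp unfolding a_def b_def d_def u by (simp add: field_simps)
  also have "\<dots> = of_real (- 2 * (Re z - Im z)) * \<i>"
    by (simp add: uz complex_eq_iff)
  finally have eq: "of_real (- 2 * (Re z - Im z)) * \<i> =
      g u - (a * g z + b * g (z + of_real c) + d * g (z + of_real (2 * c)))" ..
  have t1: "cmod (t - 1) \<le> 3" and t2: "cmod (t - 2) \<le> 4"
    using t norm_triangle_ineq4[of t 1] norm_triangle_ineq4[of t 2] by auto
  have "cmod (t - 1) * cmod (t - 2) \<le> 3 * 4" using t1 t2 by (intro mult_mono) auto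
  then have a: "cmod a \<le> 6" by (simp add: a_def norm_mult norm_divide)
  have "cmod t * cmod (t - 2) \<le> 2 * 4" using t t2 by (intro mult_mono) auto
  then have b: "cmod b \<le> 8" by (simp add: b_def norm_mult norm_minus_commute)
  have "cmod t * cmod (t - 1) \<le> 2 * 3" using t t1 by (intro mult_mono) auto
  then have d: "cmod d \<le> 3" by (simp add: d_def norm_mult norm_divide)
  have "2 * \<bar>Re z - Im z\<bar> = cmod (of_real (- 2 * (Re z - Im z)) * \<i>)"
    by (simp only: norm_mult norm_of_real abs_mult norm_ii abs_neg_numeral mult_1_right)
  also have "\<dots> \<le> A + (cmod a * B + cmod b * C + cmod d * D)"
    unfolding eq A_def B_def C_def D_def norm_mult[symmetric]
    by (rule order_trans[OF norm_triangle_ineq4] add_left_mono norm_triangle_le add_mono order_refl)+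
  also have "\<dots> \<le> A + (6 * B + 8 * C + 3 * D)"
    using a b d by (intro add_mono mult_right_mono) (auto simp: B_def C_def D_def)
  finally have "(2 * \<bar>Re z - Im z\<bar>)\<^sup>2 \<le> (A + (6 * B + 8 * C + 3 * D))\<^sup>2"
    by (rule power_mono) simp
  also have "\<dots> \<le> 110 * (A\<^sup>2 + B\<^sup>2 + C\<^sup>2 + D\<^sup>2)"
  proof -
    \<comment> \<open>By Lagrange's identity for the vectors (1, 6, 8, 3) and (A, B, C, D), this sum
      is the difference of the two sides.\<close>
    have "0 \<le> (6*A - B)\<^sup>2 + (8*A - C)\<^sup>2 + (3*A - D)\<^sup>2
        + (6*C - 8*B)\<^sup>2 + (6*D - 3*B)\<^sup>2 + (8*D - 3*C)\<^sup>2" by simp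
    then show ?thesis by (simp add: power2_eq_square algebra_simps)
  qed
  finally show ?thesis by (simp add: A_def B_def C_def D_def u_def power_mult_distrib)
qed

text \<open>The pointwise defect is integrated over a piece \<open>T\<close> of the horizontal leg,
  of area \<open>L * w / 8\<close>. Each of the four error terms integrates to at most the whole
  error, whence \<open>225280 = 512 * 440\<close> with \<open>512 = 8 * 64\<close> and
  \<open>440 = 4 * 110\<close>.\<close>

lemma integral_defect_lshape:
  fixes p :: "complex poly"
  assumes deg: "degree p \<le> 2" and w: "0 < w" "16 * w \<le> L"
  shows "L ^ 3 * w \<le> 225280 * (LINT z:lshape L w|lebesgue. (cmod (cnj z - poly p z))\<^sup>2)"
proof -
  \<comment> \<open>Extending the error by zero to the whole plane lets reflection and translations
    act without changing its integral.\<close>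
  define f where "f z = indicator (lshape L w) z * (cmod (cnj z - poly p z))\<^sup>2" for z
  \<comment> \<open>For \<open>z\<close> in \<open>T\<close> the nodes \<open>z\<close>,
    \<open>z + c\<close>, \<open>z + 2c\<close> have real part below \<open>3 * L / 4\<close>, so
    they stay in the horizontal leg, and \<open>reflect z\<close> lies in the vertical one.\<close>
  define c where "c = L / 4"
  define T where "T = box (Complex (L/8) 0) (Complex (L/4) w)"
  have f_nonneg: "f z \<ge> 0" for z by (simp add: f_def)
  have S_borel : "lshape L w \<in> sets borel" by (rule borel_open[OF open_lshape])
  have f_borel [measurable]: "f \<in> borel_measurable borel"
    unfolding f_def
    by (intro borel_measurable_times borel_measurable_indicator S_borel
        borel_measurable_continuous_onI continuous_intros)
  have f_int: "integrable lborel f"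
  proof -
    let ?K = "cbox 0 (Complex L L)"
    have "set_integrable lborel ?K (\<lambda>z. (cmod (cnj z - poly p z))\<^sup>2)"
      unfolding set_integrable_def
      by (intro borel_integrable_compact continuous_intros) auto
    then have "set_integrable lborel (lshape L w) (\<lambda>z. (cmod (cnj z - poly p z))\<^sup>2)"
      by (rule set_integrable_subset)
        (use w S_borel in \<open>auto simp: mem_lshape in_cbox_complex_iff\<close>)
    then show ?thesis by (simp add: set_integrable_def f_def[abs_def])
  qed
  have inv_int: "integrable lborel (\<lambda>z. f (h z))" "(\<integral>z. f (h z) \<partial>lborel) = (\<integral>z. f z \<partial>lborel)"
    if h: "h \<in> borel_measurable borel" "distr lborel borel h = lborel" for h
  proof -
    have h': "h \<in> measurable lborel borel" using h(1) by simp
    show "integrable lborel (\<lambda>z. f (h z))"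
      using integrable_distr_eq[OF h' f_borel] f_int h(2) by simp
    show "(\<integral>z. f (h z) \<partial>lborel) = (\<integral>z. f z \<partial>lborel)"
      using integral_distr[OF h' f_borel] h(2) by simp
  qed
  note R = inv_int[OF reflect_measurable distr_lborel_reflect]
  have tr: "integrable lborel (\<lambda>z. f (z + v))" "(\<integral>z. f (z + v) \<partial>lborel) = (\<integral>z. f z \<partial>lborel)" for v
    using inv_int[OF _ lborel_distr_plus, of v] by (simp_all add: add.commute)
  let ?F = "\<lambda>z. f (reflect z) + f z + f (z + of_real c) + f (z + of_real (2 * c))"
  have T_fin: "emeasure lborel T < \<infinity>" unfolding T_def by (rule emeasure_lborel_box_finite)
  have pt: "indicator T z * (L\<^sup>2 / 64) \<le> 110 * ?F z" for z
  proof (cases "z \<in> T")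
    case True
    then have z: "L / 8 < Re z" "Re z < L / 4" "0 < Im z" "Im z < w"
      by (auto simp: T_def in_box_complex_iff)
    \<comment> \<open>Here \<open>Re z > L / 8\<close>, and \<open>16 * w \<le> L\<close> gives
      \<open>Im z < L / 16\<close>.\<close>
    have "L / 16 \<le> Re z - Im z" using z w by simp
    then have "4 * (L / 16)\<^sup>2 \<le> 4 * (Re z - Im z)\<^sup>2" using w by (intro mult_left_mono power_mono) auto
    also have "\<dots> \<le> 110 * ?F z"
      using quadratic_extrapolation_defect[OF deg, of c z] z w
      by (simp add: f_def mem_lshape reflect_def c_def)
    finally show ?thesis using True by (simp add: power2_eq_square)
  next
    case False
    then show ?thesis using f_nonneg by simp
  qed
  have "(\<integral>z. indicator T z * (L\<^sup>2 / 64) \<partial>lborel) \<le> (\<integral>z. 110 * ?F z \<partial>lborel)"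
  proof (rule integral_mono)
    show "integrable lborel (\<lambda>z. indicator T z * (L\<^sup>2 / 64))"
      using T_fin by (intro integrable_mult_left integrable_real_indicator) (auto simp: T_def)
    show "integrable lborel (\<lambda>z. 110 * ?F z)"
      by (intro integrable_mult_right Bochner_Integration.integrable_add R(1) tr(1) f_int)
  qed (rule pt)
  also have "(\<integral>z. 110 * ?F z \<partial>lborel) = 440 * (\<integral>z. f z \<partial>lborel)"
    by (simp add: R tr f_int)
  also have "(\<integral>z. indicator T z * (L\<^sup>2 / 64) \<partial>lborel) = measure lborel T * (L\<^sup>2 / 64)"
    by simp
  also have "measure lborel T = L / 8 * w"
    using w by (simp add: T_def measure_lborel_box_complex)
  \<comment> \<open>\<open>lebesgue\<close> is the completion of \<open>lborel\<close>, and
    \<open>f\<close> is Borel, so the two integrals agree.\<close>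
  also have "(\<integral>z. f z \<partial>lborel) = (LINT z:lshape L w|lebesgue. (cmod (cnj z - poly p z))\<^sup>2)"
    unfolding set_lebesgue_integral_def
    by (subst integral_completion) (simp_all add: f_def[symmetric])
  finally show ?thesis by (simp add: power2_eq_square power3_eq_cube mult_ac)
qed

section \<open>Unboundedness at fixed area\<close>

theorem theorem2p2:
  fixes j :: nat
  assumes "j \<in> {1, 2}"
  shows "\<not> (\<exists>H\<^sub>0. hexagon H\<^sub>0 \<and> measure lebesgue H\<^sub>0 = 1 \<and>
           (\<forall>H. hexagon H \<and> measure lebesgue H = 1 \<longrightarrow> rho j H \<le> rho j H\<^sub>0))"
proof
  assume "\<exists>H\<^sub>0. hexagon H\<^sub>0 \<and> measure lebesgue H\<^sub>0 = 1 \<and>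
           (\<forall>H. hexagon H \<and> measure lebesgue H = 1 \<longrightarrow> rho j H \<le> rho j H\<^sub>0)"
  \<comment> \<open>A maximizer would give a finite upper bound, and already that is
    contradictory.\<close>
  then obtain M where M: "\<And>H. hexagon H \<Longrightarrow> measure lebesgue H = 1 \<Longrightarrow> rho j H \<le> M"
    by blast
  \<comment> \<open>The constant is \<open>8 * 225280\<close>, twice the factor in the final bound
    \<open>K \<le> 901120 * M\<close>; \<open>1 + \<bar>M\<bar>\<close> keeps \<open>K\<close>
    positive for every sign of \<open>M\<close>.\<close>
  define K where "K = 1802240 * (1 + \<bar>M\<bar>)"
  define w where "w = 1 / K"
  \<comment> \<open>The solution of the area equation
    \<open>2 * L * w - w\<^sup>2 = 1\<close>.\<close>
  define L where "L = (1 + w\<^sup>2) / (2 * w)"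
  have K: "K \<ge> 1802240" by (simp add: K_def)
  have w: "0 < w" "w \<le> 1" using K by (auto simp: w_def field_simps)
  have Lw: "2 * (L * w) = 1 + w\<^sup>2" using w by (simp add: L_def)
  have L: "K / 2 \<le> L" using K by (simp add: L_def w_def field_simps)
  have Lw16: "16 * w \<le> L" using w L K by simp
  have hex: "hexagon (lshape L w)" using w Lw16 by (intro hexagon_lshape) auto
  have area: "measure lebesgue (lshape L w) = 1"
    using measure_lshape[of w L] Lw w Lw16 by simp
  have "L ^ 3 * w / 225280 \<le> rho j (lshape L w)"
    unfolding rho_def
  proof (rule cINF_greatest)
    show "{p :: complex poly. degree p \<le> j} \<noteq> {}" by (auto intro: exI[of _ 0])
    fix p :: "complex poly" assume "p \<in> {p. degree p \<le> j}"
    \<comment> \<open>The quadratic estimate serves both values of \<open>j\<close>; being uniform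
      in \<open>p\<close>, it passes to the infimum.\<close>
    then have "degree p \<le> 2" using assms by auto
    from integral_defect_lshape[OF this w(1) Lw16]
    show "L ^ 3 * w / 225280 \<le> (LINT z:lshape L w|lebesgue. (cmod (cnj z - poly p z))\<^sup>2)"
      by simp
  qed
  also have "\<dots> \<le> M" by (rule M[OF hex area])
  finally have "L\<^sup>2 * (L * w) \<le> 225280 * M" by (simp add: power2_eq_square power3_eq_cube)
  \<comment> \<open>Together with \<open>L * w \<ge> 1/2\<close> this yields
    \<open>K / 2 \<le> L \<le> L\<^sup>2 \<le> 450560 * M\<close>.\<close>
  moreover have "L * 1 \<le> L * L" using L K by (intro mult_left_mono) auto
  moreover have "L\<^sup>2 * (1 / 2) \<le> L\<^sup>2 * (L * w)"
    using Lw zero_le_power2[of w] by (intro mult_left_mono) (linarith, simp)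
  ultimately have "K \<le> 901120 * M" using L by (simp add: power2_eq_square)
  then show False by (simp add: K_def abs_if split: if_splits)
qed

end
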